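(* Let $A,B \subset \mathbb{R}$ be finite sets and let $G \subset A \times B$. Then \[ \max \{|A+_G B|,\ |A \cdot_G B| \}\gg \frac{|G|^{3/4}}{|A|^{3/8}}. \] In particular, for any $\epsilon>0$, if $|G| \geq |A|^{3/2+ \epsilon}$ then \[ \max \{|A+_G B|,\ |A \cdot_G B| \}\gg |G|^{1/2+ \epsilon'},\qquad \text{where } \epsilon'=\frac{4\epsilon}{24+16\epsilon}. \]
   Context: For finite $A,B\subset\mathbb{R}$ and $G\subset A\times B$: $A+_G B:=\{a+b : (a,b)\in G\}$ and $A\cdot_G B:=\{ab : (a,b)\in G\}$. The notation $X\gg Y$ means $X\ge cY$ for some absolute constant $c>0$. *)

theory Defs
  imports Complex_Main
begin

definition sumset_along :: "(real \<times> real) set \<Rightarrow> real set \<Rightarrow> real set \<Rightarrow> real set" where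
  "sumset_along G A B = {a + b | a b. a \<in> A \<and> b \<in> B \<and> (a, b) \<in> G}"

definition prodset_along :: "(real \<times> real) set \<Rightarrow> real set \<Rightarrow> real set \<Rightarrow> real set" where
  "prodset_along G A B = {a * b | a b. a \<in> A \<and> b \<in> B \<and> (a, b) \<in> G}"

end

theory Submission
  imports Defs "HOL-Analysis.Convex"
begin

text \<open>
  Let \<open>S\<close> and \<open>P\<close> be the sums and products along \<open>G\<close>, both of size at most \<open>M\<close>. By Cauchy--Schwarz,
  \<open>|G|\<^sup>2 / |A|\<close> is at most the number of triples \<open>(a, b, c)\<close> with \<open>(a, b), (a, c) \<in> G\<close>. Such a
  triple is an incidence between the point \<open>(a b, a c)\<close> of the grid \<open>P \<times> P\<close> and the parabola
  \<open>t \<mapsto> (t s - t\<^sup>2, t s' - t\<^sup>2)\<close> with \<open>s = a + b\<close>, \<open>s' = a + c\<close> in \<open>S\<close>. No general incidence theorem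
  is needed, because the points form a grid: cut \<open>P\<close> into blocks of about \<open>M\<^bsup>1/3\<^esup>\<close> consecutive
  elements, so that a parabola, being piecewise monotone, meets only \<open>O(M\<^bsup>2/3\<^esup>)\<close> cells, while the
  incidences that are not alone on their parabola in their cell are controlled by pairs of points
  of a common cell, each pair lying on at most two of the parabolas. Both contributions are
  \<open>O(M\<^bsup>8/3\<^esup>)\<close>, that is, \<open>|G|\<^sup>2 / |A| = O(M\<^bsup>8/3\<^esup>)\<close>.
\<close>

section \<open>Counting by collisions and along staircases\<close>

text \<open>Fix one representative in each fibre of \<open>f\<close>: there are as many
  representatives as values, and every other element collides with the representative of its
  fibre.\<close>

lemma card_le_card_image_plus_collisions:
  assumes "finite Q"
  shows "card Q \<le> card (f ` Q) + card {(x, y). x \<in> Q \<and> y \<in> Q \<and> x \<noteq> y \<and> f x = f y}"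
    (is "_ \<le> _ + card ?C")
proof -
  define r where "r x = inv_into Q f (f x)" for x
  have r: "r x \<in> Q" "f (r x) = f x" if "x \<in> Q" for x
    using that unfolding r_def by (auto intro: inv_into_into f_inv_into_f)
  have "finite ?C"
    by (rule finite_subset[of _ "Q \<times> Q"]) (use assms in auto)
  moreover have "(\<lambda>x. (x, r x)) ` {x \<in> Q. x \<noteq> r x} \<subseteq> ?C"
    using r by auto
  ultimately have "card {x \<in> Q. x \<noteq> r x} \<le> card ?C"
    by (intro card_inj_on_le[where f = "\<lambda>x. (x, r x)"]) (auto simp: inj_on_def)
  moreover have "card {x \<in> Q. x = r x} \<le> card (f ` Q)"
    by (rule card_inj_on_le[where f = f])
      (use assms in \<open>auto simp: inj_on_def r_def\<close>)
  moreover have "card Q \<le> card {x \<in> Q. x = r x} + card {x \<in> Q. x \<noteq> r x}"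
    using card_Un_le[of "{x \<in> Q. x = r x}" "{x \<in> Q. x \<noteq> r x}"]
    by (simp flip: Collect_disj_eq conj_disj_distribL)
  ultimately show ?thesis by linarith
qed

text \<open>The signed sum \<open>\<sigma> * f + \<tau> * g\<close> is monotone along
  \<open>T\<close> and cannot stay constant unless both coordinates do. It therefore separates the
  points of the staircase, and it is an integer between \<open>- 2 * n\<close> and
  \<open>2 * n\<close>.\<close>

lemma card_monotone_staircase_le:
  fixes f g :: "'a::linorder \<Rightarrow> nat" and \<sigma> \<tau> :: int
  assumes bound: "\<And>t. t \<in> T \<Longrightarrow> f t \<le> n \<and> g t \<le> n"
    and signs: "\<bar>\<sigma>\<bar> = 1" "\<bar>\<tau>\<bar> = 1"
    and mono: "mono_on T (\<lambda>t. \<sigma> * int (f t))" "mono_on T (\<lambda>t. \<tau> * int (g t))"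
  shows "card ((\<lambda>t. (f t, g t)) ` T) \<le> 4 * n + 1"
proof -
  let ?h = "\<lambda>(x, y). \<sigma> * int x + \<tau> * int y"
  have eq: "f t = f u \<and> g t = g u"
    if "t \<in> T" "u \<in> T" "t \<le> u" "?h (f t, g t) = ?h (f u, g u)" for t u
  proof -
    have "\<sigma> * int (f t) \<le> \<sigma> * int (f u)" "\<tau> * int (g t) \<le> \<tau> * int (g u)"
      using mono that by (auto simp: mono_on_def)
    with that(4) have "\<sigma> * int (f t) = \<sigma> * int (f u)" "\<tau> * int (g t) = \<tau> * int (g u)"
      unfolding prod.case by linarith+
    with signs show ?thesis by auto
  qed
  have "inj_on ?h ((\<lambda>t. (f t, g t)) ` T)"
  proof (rule inj_onI)
    fix x y
    assume "x \<in> (\<lambda>t. (f t, g t)) ` T" "y \<in> (\<lambda>t. (f t, g t)) ` T" and h: "?h x = ?h y"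
    then obtain t u where "t \<in> T" "u \<in> T" "x = (f t, g t)" "y = (f u, g u)"
      by blast
    then show "x = y"
      using eq[of t u] eq[of u t] h linear[of t u] by metis
  qed
  moreover have "?h ` (\<lambda>t. (f t, g t)) ` T \<subseteq> {- 2 * int n..2 * int n}"
  proof -
    have "\<sigma> = 1 \<or> \<sigma> = -1" "\<tau> = 1 \<or> \<tau> = -1"
      using signs by auto
    then show ?thesis
      using bound by fastforce
  qed
  ultimately have "card ((\<lambda>t. (f t, g t)) ` T) \<le> card {- 2 * int n..2 * int n}"
    by (intro card_inj_on_le) auto
  then show ?thesis by simp
qed

section \<open>Blocks of consecutive elements\<close>

text \<open>Rank in \<open>P\<close> divided by the block length. It is defined on all reals, not
  only on \<open>P\<close>, so that it stays monotone along a whole parabola.\<close>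

definition block_index :: "nat \<Rightarrow> real set \<Rightarrow> real \<Rightarrow> nat" where
  "block_index K P x = card {q \<in> P. q < x} div K"

lemma block_index_mono:
  assumes "finite P" "x \<le> y"
  shows "block_index K P x \<le> block_index K P y"
  unfolding block_index_def
  by (intro div_le_mono card_mono) (use assms in auto)

lemma block_index_le:
  assumes "finite P"
  shows "block_index K P x \<le> card P div K"
  unfolding block_index_def
  by (intro div_le_mono card_mono) (use assms in auto)

text \<open>The rank is injective on \<open>P\<close>, and the ranks within block \<open>i\<close>
  fill at most an interval of \<open>K\<close> integers.\<close>

lemma card_block_le:
  assumes "finite P" "K > 0"
  shows "card {q \<in> P. block_index K P q = i} \<le> K"
proof -
  let ?rank = "\<lambda>x. card {q \<in> P. q < x}"
  have less: "?rank x < ?rank y" if "x \<in> P" "x < y" for x y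
    by (rule psubset_card_mono) (use assms that in auto)
  have "inj_on ?rank P"
  proof (rule inj_onI)
    fix x y assume "x \<in> P" "y \<in> P" "?rank x = ?rank y"
    then show "x = y"
      using less[of x y] less[of y x] by (cases x y rule: linorder_cases) auto
  qed
  then have "inj_on ?rank {q \<in> P. block_index K P q = i}"
    by (rule inj_on_subset) auto
  moreover have "?rank ` {q \<in> P. block_index K P q = i} \<subseteq> {i * K..<i * K + K}"
    using dividend_less_div_times[OF assms(2)]
    by (auto simp: block_index_def add.commute)
  ultimately have "card {q \<in> P. block_index K P q = i} \<le> card {i * K..<i * K + K}"
    by (intro card_inj_on_le) auto
  then show ?thesis by simp
qed

lemma card_same_block_pairs_le:
  assumes "finite P" "K > 0"
  shows "card {(x, y). x \<in> P \<and> y \<in> P \<and> block_index K P x = block_index K P y} \<le> card P * K"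
proof -
  have "{(x, y). x \<in> P \<and> y \<in> P \<and> block_index K P x = block_index K P y} =
      (SIGMA x:P. {y \<in> P. block_index K P y = block_index K P x})"
    by auto
  moreover have "card \<dots> = (\<Sum>x\<in>P. card {y \<in> P. block_index K P y = block_index K P x})"
    using assms by (intro card_SigmaI) auto
  moreover have "\<dots> \<le> (\<Sum>x\<in>P. K)"
    using assms by (intro sum_mono card_block_le)
  ultimately show ?thesis by simp
qed

section \<open>Parabolas and the cells they meet\<close>

lemma parabola_increasing:
  fixes s t u :: real
  assumes "t \<le> u" "u \<le> s / 2"
  shows "t * s - t\<^sup>2 \<le> u * s - u\<^sup>2"
proof -
  have "0 \<le> (u - t) * (s - t - u)"
    using assms by (intro mult_nonneg_nonneg) auto
  then show ?thesis by (simp add: algebra_simps power2_eq_square)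
qed

lemma parabola_decreasing:
  fixes s t u :: real
  assumes "t \<le> u" "s / 2 \<le> t"
  shows "u * s - u\<^sup>2 \<le> t * s - t\<^sup>2"
  using parabola_increasing[of "s - u" "s - t" s] assms
  by (simp add: algebra_simps power2_eq_square)

text \<open>The coordinates turn only at the vertices \<open>s / 2\<close> and
  \<open>s' / 2\<close>. These split the line into four pieces, some possibly degenerate, and on
  each piece the cell indices form a monotone staircase.\<close>

lemma card_cells_of_parabola_le:
  fixes s s' :: real
  assumes "finite P"
  shows "finite (range (\<lambda>t. (block_index K P (t * s - t\<^sup>2), block_index K P (t * s' - t\<^sup>2))))"
    and "card (range (\<lambda>t. (block_index K P (t * s - t\<^sup>2), block_index K P (t * s' - t\<^sup>2))))
      \<le> 16 * (card P div K) + 4"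
proof -
  let ?f = "\<lambda>s t. block_index K P (t * s - t\<^sup>2)"
  let ?n = "card P div K"
  \<comment> \<open>\<open>I \<sigma> s\<close> is the side of the vertex on which
    \<open>\<sigma>\<close> times the block index is nondecreasing.\<close>
  define I where "I \<sigma> s = (if \<sigma> = 1 then {..s / 2} else {s / 2..})" for \<sigma> :: int and s :: real
  let ?g = "\<lambda>t. (?f s t, ?f s' t)"
  have mono: "mono_on (I \<sigma> s \<inter> X) (\<lambda>t. \<sigma> * int (?f s t))"
    "mono_on (X \<inter> I \<sigma> s) (\<lambda>t. \<sigma> * int (?f s t))" if "\<sigma> \<in> {1, -1}" for \<sigma> X s
  proof -
    have "mono_on (I \<sigma> s) (\<lambda>t. \<sigma> * int (?f s t))"
    proof (cases "\<sigma> = 1")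
      case True
      then show ?thesis
        using assms by (auto simp: mono_on_def I_def intro!: block_index_mono parabola_increasing)
    next
      case False
      with that have "\<sigma> = -1" by simp
      then show ?thesis
        using assms by (auto simp: mono_on_def I_def intro!: block_index_mono parabola_decreasing)
    qed
    then show "mono_on (I \<sigma> s \<inter> X) (\<lambda>t. \<sigma> * int (?f s t))"
      "mono_on (X \<inter> I \<sigma> s) (\<lambda>t. \<sigma> * int (?f s t))"
      by (auto intro: mono_on_subset)
  qed
  have piece: "card (?g ` (I \<sigma> s \<inter> I \<tau> s')) \<le> 4 * ?n + 1"
    if "\<sigma> \<in> {1, -1}" "\<tau> \<in> {1, -1}" for \<sigma> \<tau>
    by (rule card_monotone_staircase_le[where \<sigma> = \<sigma> and \<tau> = \<tau>])
      (use that mono assms block_index_le in auto)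
  have "range ?g \<subseteq> {..?n} \<times> {..?n}"
    using assms block_index_le by auto
  then show "finite (range ?g)"
    by (rule finite_subset) auto
  have "range ?g = (?g ` (I 1 s \<inter> I 1 s') \<union> ?g ` (I 1 s \<inter> I (-1) s')) \<union>
      (?g ` (I (-1) s \<inter> I 1 s') \<union> ?g ` (I (-1) s \<inter> I (-1) s'))"
    (is "_ = (?A \<union> ?B) \<union> (?C \<union> ?D)")
  proof -
    have "UNIV = (I 1 s \<inter> I 1 s' \<union> I 1 s \<inter> I (-1) s') \<union> (I (-1) s \<inter> I 1 s' \<union> I (-1) s \<inter> I (-1) s')"
      by (auto simp: I_def)
    then show ?thesis by (metis image_Un)
  qed
  then have "card (range ?g) \<le> (card ?A + card ?B) + (card ?C + card ?D)"
    using card_Un_le[of "?A \<union> ?B" "?C \<union> ?D"] card_Un_le[of ?A ?B] card_Un_le[of ?C ?D] by simp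
  also have "\<dots> \<le> 16 * ?n + 4"
    using piece[of 1 1] piece[of 1 "-1"] piece[of "-1" 1] piece[of "-1" "-1"] by simp
  finally show "card (range ?g) \<le> 16 * ?n + 4" .
qed

text \<open>The pairs \<open>(t, t')\<close> and \<open>(u, u')\<close> are the parameters of two common points of the parabolas
  \<open>t \<mapsto> (t s - t\<^sup>2, t s' - t\<^sup>2)\<close> and \<open>u \<mapsto> (u v - u\<^sup>2, u v' - u\<^sup>2)\<close>. The differences of the
  coordinates force \<open>u = \<lambda> t\<close>, \<open>u' = \<lambda> t'\<close>, and then the first coordinates force \<open>\<lambda>\<^sup>2 = 1\<close>; the
  exchange \<open>\<lambda> = -1\<close> is a genuine symmetry.\<close>
lemma parabolas_two_common_points:
  fixes s s' v v' t t' u u' :: real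
  assumes "t \<noteq> 0" "t' \<noteq> 0" "t \<noteq> t'" "s \<noteq> s'" "v \<noteq> v'"
    and sign: "0 < t \<longleftrightarrow> 0 < u" and "u \<noteq> 0"
    and 1: "t * s - t\<^sup>2 = u * v - u\<^sup>2" and 2: "t * s' - t\<^sup>2 = u * v' - u\<^sup>2"
    and 3: "t' * s - t'\<^sup>2 = u' * v - u'\<^sup>2" and 4: "t' * s' - t'\<^sup>2 = u' * v' - u'\<^sup>2"
  shows "t = u \<and> t' = u'"
proof -
  define l where "l = (s - s') / (v - v')"
  have "u * (v - v') = t * (s - s')"
    using 1 2 by (simp add: algebra_simps)
  then have u: "u = l * t"
    using assms by (simp add: l_def field_simps)
  have "u' * (v - v') = t' * (s - s')"
    using 3 4 by (simp add: algebra_simps)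
  then have u': "u' = l * t'"
    using assms by (simp add: l_def field_simps)
  have "t * (s - t) = t * (l * v - l\<^sup>2 * t)"
    using 1 by (simp add: u algebra_simps power2_eq_square)
  then have a: "s - t = l * v - l\<^sup>2 * t"
    using assms by simp
  have "t' * (s - t') = t' * (l * v - l\<^sup>2 * t')"
    using 3 by (simp add: u' algebra_simps power2_eq_square)
  then have b: "s - t' = l * v - l\<^sup>2 * t'"
    using assms by simp
  have "(t - t') * l\<^sup>2 = (t - t') * 1"
    using a b by (simp add: algebra_simps)
  then have "l\<^sup>2 = 1"
    using assms by simp
  then have "l = 1 \<or> l = -1"
    by (simp add: power2_eq_1_iff)
  moreover have "l \<noteq> -1"
    using sign \<open>t \<noteq> 0\<close> u by auto
  ultimately show ?thesis
    using u u' by simp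
qed

section \<open>Counting cherries, the pairs of edges with a common left endpoint\<close>

text \<open>The first term counts pairs of a parabola and a cell it meets, the second counts
  collisions within such a pair. The conditions \<open>a \<noteq> 0\<close> and
  \<open>b \<noteq> c\<close> supply the nonzero parameters and distinct sums that
  \<open>parabolas_two_common_points\<close> requires.\<close>

lemma card_cherries_le:
  fixes G :: "(real \<times> real) set"
  assumes fin: "finite G" "finite S" "finite P" and "K > 0"
    and SP: "\<And>a b. (a, b) \<in> G \<Longrightarrow> a + b \<in> S \<and> a * b \<in> P"
  shows "card {(a, b, c). (a, b) \<in> G \<and> (a, c) \<in> G \<and> a \<noteq> 0 \<and> b \<noteq> c}
    \<le> (card S)\<^sup>2 * (16 * (card P div K) + 4) + 2 * (card P * K)\<^sup>2"
proof -
  let ?Q = "{(a, b, c). (a, b) \<in> G \<and> (a, c) \<in> G \<and> a \<noteq> 0 \<and> b \<noteq> c}"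
  let ?i = "block_index K P"
  let ?n = "card P div K"
  define f where "f = (\<lambda>(a::real, b, c). ((a + b, a + c), ?i (a * b), ?i (a * c)))"
  define R where "R = (\<lambda>(s, s'). range (\<lambda>t::real. (?i (t * s - t\<^sup>2), ?i (t * s' - t\<^sup>2))))"
  define D where "D = {(x, y). x \<in> P \<and> y \<in> P \<and> ?i x = ?i y}"
  define C where "C = {(x, y). x \<in> ?Q \<and> y \<in> ?Q \<and> x \<noteq> y \<and> f x = f y}"
  have "finite ?Q"
    by (rule finite_subset[of _ "(\<lambda>((a, b), (a', c)). (a, b, c)) ` (G \<times> G)"])
      (use fin in force)+
  then have *: "card ?Q \<le> card (f ` ?Q) + card C"
    unfolding C_def by (rule card_le_card_image_plus_collisions)
  have R: "finite (R w)" "card (R w) \<le> 16 * ?n + 4" for w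
    using card_cells_of_parabola_le[OF fin(3)] by (auto simp: R_def split: prod.split)
  have "f ` ?Q \<subseteq> Sigma (S \<times> S) R"
  proof (rule image_subsetI)
    fix x assume "x \<in> ?Q"
    then obtain a b c where x: "x = (a, b, c)" and "(a, b) \<in> G" "(a, c) \<in> G"
      by auto
    \<comment> \<open>The parabola passes through the point at parameter \<open>t = a\<close>, since
      \<open>a * (a + b) - a^2 = a * b\<close>.\<close>
    moreover have "(?i (a * b), ?i (a * c)) \<in> R (a + b, a + c)"
      unfolding R_def by (auto intro!: image_eqI[of _ _ a] simp: algebra_simps power2_eq_square)
    ultimately show "f x \<in> Sigma (S \<times> S) R"
      using SP by (auto simp: f_def)
  qed
  then have "card (f ` ?Q) \<le> card (Sigma (S \<times> S) R)"
    using fin R by (intro card_mono) auto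
  also have "\<dots> = (\<Sum>w\<in>S \<times> S. card (R w))"
    using fin R by (intro card_SigmaI) auto
  also have "\<dots> \<le> (\<Sum>w\<in>S \<times> S. 16 * ?n + 4)"
    by (intro sum_mono R)
  finally have image: "card (f ` ?Q) \<le> (card S)\<^sup>2 * (16 * ?n + 4)"
    by (simp add: card_cartesian_product power2_eq_square)
  \<comment> \<open>A collision is encoded by its two points, regrouped by coordinate so that each
    pair lies in one block. The sign of \<open>a\<close> resolves the exchange symmetry and costs
    the factor 2.\<close>
  define h where "h = (\<lambda>((a::real, b::real, c::real), (a'::real, b'::real, c'::real)).
    (((a * b, a' * b'), (a * c, a' * c')), 0 < a))"
  have "inj_on h C"
  proof (rule inj_onI)
    fix x y assume x: "x \<in> C" and y: "y \<in> C" and "h x = h y"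
    obtain a b c a' b' c' where X: "x = ((a, b, c), (a', b', c'))" by (metis prod.exhaust)
    obtain u v w u' v' w' where Y: "y = ((u, v, w), (u', v', w'))" by (metis prod.exhaust)
    have hx: "a \<noteq> 0" "a' \<noteq> 0" "b \<noteq> c" "a + b = a' + b'" "a + c = a' + c'" "(a, b, c) \<noteq> (a', b', c')"
      using x by (auto simp: C_def X f_def)
    have hy: "u \<noteq> 0" "u' \<noteq> 0" "v \<noteq> w" "u + v = u' + v'" "u + w = u' + w'"
      using y by (auto simp: C_def Y f_def)
    have e: "a * b = u * v" "a * c = u * w" "a' * b' = u' * v'" "a' * c' = u' * w'" "0 < a \<longleftrightarrow> 0 < u"
      using \<open>h x = h y\<close> by (auto simp: h_def X Y)
    have s: "b' = a + b - a'" "c' = a + c - a'" "v' = u + v - u'" "w' = u + w - u'"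
      using hx hy by auto
    \<comment> \<open>The parameters \<open>a\<close> and \<open>a'\<close> differ: with equal sums,
      \<open>a = a'\<close> would make the two cherries equal.\<close>
    have "a = u \<and> a' = u'"
      by (rule parabolas_two_common_points[of a a' "a + b" "a + c" "u + v" "u + w" u u'])
        (use hx hy e in \<open>auto simp: s algebra_simps power2_eq_square\<close>)
    with hx hy e show "x = y"
      by (auto simp: X Y)
  qed
  moreover have "h ` C \<subseteq> (D \<times> D) \<times> UNIV"
    using SP by (auto simp: h_def C_def D_def f_def)
  moreover have finD: "finite D"
    by (rule finite_subset[of _ "P \<times> P"]) (use fin in \<open>auto simp: D_def\<close>)
  ultimately have "card C \<le> card ((D \<times> D) \<times> (UNIV :: bool set))"
    by (intro card_inj_on_le) auto
  also have "\<dots> = 2 * (card D)\<^sup>2"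
    by (simp add: card_cartesian_product power2_eq_square)
  also have "\<dots> \<le> 2 * (card P * K)\<^sup>2"
    using card_same_block_pairs_le[OF fin(3) \<open>K > 0\<close>] unfolding D_def by (simp add: power_mono)
  finally show ?thesis
    using * image by linarith
qed

text \<open>Sum and product determine \<open>a\<close> and \<open>b\<close> as the roots of a
  quadratic; the truth value of \<open>a \<le> b\<close> fixes their order.\<close>

lemma card_le_two_card_sums_card_products:
  fixes G :: "(real \<times> real) set"
  assumes "finite S" "finite P" and SP: "\<And>a b. (a, b) \<in> G \<Longrightarrow> a + b \<in> S \<and> a * b \<in> P"
  shows "card G \<le> 2 * card S * card P"
proof -
  let ?h = "\<lambda>(a::real, b). ((a + b, a * b), a \<le> b)"
  have "inj_on ?h G"
  proof (rule inj_onI, clarify)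
    fix a b u v :: real
    assume e: "a + b = u + v" "a * b = u * v" "a \<le> b \<longleftrightarrow> u \<le> v"
    have "(a - u) * (a - v) = 0"
      using e by (simp add: algebra_simps) (metis distrib_left)
    then show "a = u \<and> b = v"
      using e by auto
  qed
  moreover have "?h ` G \<subseteq> (S \<times> P) \<times> UNIV"
    using SP by auto
  ultimately have "card G \<le> card ((S \<times> P) \<times> (UNIV :: bool set))"
    by (rule card_inj_on_le) (use assms in auto)
  then show ?thesis
    by (simp add: card_cartesian_product)
qed

text \<open>Block length about \<open>M powr (1/3)\<close> balances the two terms of
  \<open>card_cherries_le\<close>. The degenerate cherries, with \<open>b = c\<close> or
  \<open>a = 0\<close>, contribute only \<open>O(M^2)\<close>.\<close>

lemma card_all_cherries_le:
  fixes G :: "(real \<times> real) set"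
  assumes fin: "finite G" "finite S" "finite P"
    and SP: "\<And>a b. (a, b) \<in> G \<Longrightarrow> a + b \<in> S \<and> a * b \<in> P"
    and M: "card S \<le> M" "card P \<le> M"
  shows "real (card {(a, b, c). (a, b) \<in> G \<and> (a, c) \<in> G}) \<le> 31 * real M powr (8/3)"
proof (cases "M = 0")
  case True
  then have "G = {}"
    using M fin SP by fastforce
  then show ?thesis by (simp add: case_prod_unfold)
next
  case False
  then have M1: "1 \<le> real M" by simp
  define m where "m = real M powr (1/3)"
  have m1: "1 \<le> m" unfolding m_def using M1 by (simp add: ge_one_powr_ge_zero)
  have m3: "m ^ 3 = real M"
    using M1 by (simp add: m_def powr_realpow[symmetric] powr_powr)
  have m8: "m ^ 8 = real M powr (8/3)"
    using M1 by (simp add: m_def powr_realpow[symmetric] powr_powr)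
  \<comment> \<open>Rounding up keeps the number of full blocks at most \<open>m^2\<close>, while
    \<open>m \<ge> 1\<close> gives \<open>K \<le> 2 * m\<close>.\<close>
  define K where "K = nat \<lceil>m\<rceil>"
  have K: "m \<le> real K" "real K \<le> 2 * m" "K > 0"
    using m1 unfolding K_def by linarith+
  let ?Q = "{(a, b, c). (a, b) \<in> G \<and> (a, c) \<in> G \<and> a \<noteq> 0 \<and> b \<noteq> c}"
  let ?E = "{(a, b, c). (a, b) \<in> G \<and> (a, c) \<in> G}"
  have "real (card P div K) \<le> real (card P) / real K"
    by (rule of_nat_div_le_of_nat)
  also have "\<dots> \<le> m ^ 3 / m"
    using M K m1 m3 by (intro frac_le) auto
  also have "\<dots> = m\<^sup>2"
    using m1 by (simp add: power2_eq_square power3_eq_cube)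
  finally have N: "real (card P div K) \<le> m\<^sup>2" .
  have S: "real (card S) \<le> m ^ 3" and P: "real (card P) \<le> m ^ 3"
    using M m3 by auto
  have "real (card ?Q) \<le> real ((card S)\<^sup>2 * (16 * (card P div K) + 4) + 2 * (card P * K)\<^sup>2)"
    using card_cherries_le[OF fin K(3) SP] by (simp only: of_nat_le_iff)
  also have "\<dots> = (real (card S))\<^sup>2 * (16 * real (card P div K) + 4) + 2 * (real (card P) * real K)\<^sup>2"
    by simp
  \<comment> \<open>The additive 4 is absorbed into \<open>4 * m^2\<close>; the two terms then give
    \<open>20 * m^8\<close> and \<open>8 * m^8\<close>.\<close>
  also have "\<dots> \<le> (m ^ 3)\<^sup>2 * (16 * m\<^sup>2 + 4 * m\<^sup>2) + 2 * (m ^ 3 * (2 * m))\<^sup>2"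
    using S P N K m1 by (intro add_mono mult_mono power_mono) auto
  also have "\<dots> = 28 * m ^ 8"
    by (simp add: power_mult_distrib flip: power_mult power_add)
  finally have Q: "real (card ?Q) \<le> 28 * m ^ 8" .
  have "real (card G) \<le> real (2 * card S * card P)"
    using card_le_two_card_sums_card_products[OF fin(2,3) SP] by (simp only: of_nat_le_iff)
  also have "\<dots> \<le> 2 * m ^ 3 * m ^ 3"
    using S P m1 by (simp add: mult_mono)
  also have "\<dots> = 2 * m ^ 6"
    by (simp flip: power_add)
  finally have diag: "real (card G) \<le> 2 * m ^ 6" .
  let ?Z = "{b. (0, b) \<in> G}"
  \<comment> \<open>For \<open>a = 0\<close> the sum is \<open>b\<close> itself.\<close>
  have "?Z \<subseteq> S" using SP by fastforce
  then have Z: "finite ?Z" "card ?Z \<le> card S"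
    using fin finite_subset card_mono by blast+
  have "?E \<subseteq> (?Q \<union> (\<lambda>(a, b). (a, b, b)) ` G) \<union> (\<lambda>(b, c). (0, b, c)) ` (?Z \<times> ?Z)"
    by force
  moreover have "finite ?Q"
    by (rule finite_subset[of _ "(\<lambda>((a, b), (a', c)). (a, b, c)) ` (G \<times> G)"])
      (use fin in force)+
  ultimately have "card ?E \<le> card ((?Q \<union> (\<lambda>(a, b). (a, b, b)) ` G) \<union> (\<lambda>(b, c). (0, b, c)) ` (?Z \<times> ?Z))"
    using fin Z by (intro card_mono) auto
  also have "\<dots> \<le> (card ?Q + card ((\<lambda>(a, b). (a, b, b)) ` G)) + card ((\<lambda>(b, c). (0::real, b, c)) ` (?Z \<times> ?Z))"
    by (meson add_le_mono1 card_Un_le le_trans)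
  also have "\<dots> \<le> (card ?Q + card G) + card (?Z \<times> ?Z)"
    by (intro add_mono card_image_le order_refl) (use fin Z in auto)
  also have "\<dots> \<le> card ?Q + card G + (card S)\<^sup>2"
    using Z by (simp add: card_cartesian_product power2_eq_square mult_mono)
  finally have "real (card ?E) \<le> real (card ?Q + card G + (card S)\<^sup>2)"
    by (simp only: of_nat_le_iff)
  also have "\<dots> \<le> 28 * m ^ 8 + 2 * m ^ 6 + (m ^ 3)\<^sup>2"
    unfolding of_nat_add of_nat_power by (intro add_mono Q diag power_mono S) simp
  also have "\<dots> = 28 * m ^ 8 + 3 * m ^ 6"
    by (simp flip: power_mult)
  also have "\<dots> \<le> 31 * m ^ 8"
    using power_increasing[of 6 8 m] m1 by simp
  finally show ?thesis by (simp add: m8)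
qed

section \<open>Cauchy-Schwarz and the final bounds\<close>

text \<open>Cauchy-Schwarz for the degrees of the vertices in \<open>A\<close>: they sum to
  \<open>card G\<close>, and their squares sum to the number of cherries.\<close>

lemma card_edges_squared_le:
  fixes G :: "('a \<times> 'b) set"
  assumes "finite A" "finite G" "fst ` G \<subseteq> A"
  shows "(card G)\<^sup>2 \<le> card A * card {(a, b, c). (a, b) \<in> G \<and> (a, c) \<in> G}"
proof -
  let ?N = "\<lambda>a. {b. (a, b) \<in> G}"
  have fin: "finite (?N a)" for a
    by (rule finite_subset[of _ "snd ` G"]) (use assms in force)+
  have "G = Sigma A ?N" using assms by force
  then have "card G = card (Sigma A ?N)" by simp
  also have "\<dots> = (\<Sum>a\<in>A. card (?N a))"
    using assms fin by (intro card_SigmaI) auto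
  finally have G: "card G = (\<Sum>a\<in>A. card (?N a))" .
  have "{(a, b, c). (a, b) \<in> G \<and> (a, c) \<in> G} = (SIGMA a:A. ?N a \<times> ?N a)"
    using assms by force
  then have "card {(a, b, c). (a, b) \<in> G \<and> (a, c) \<in> G} = card (SIGMA a:A. ?N a \<times> ?N a)"
    by simp
  also have "\<dots> = (\<Sum>a\<in>A. (card (?N a))\<^sup>2)"
    using assms fin by (subst card_SigmaI) (auto simp: card_cartesian_product power2_eq_square)
  finally have E: "card {(a, b, c). (a, b) \<in> G \<and> (a, c) \<in> G} = (\<Sum>a\<in>A. (card (?N a))\<^sup>2)" .
  have "(\<Sum>a\<in>A. real (card (?N a)))\<^sup>2 \<le> real (card A) * (\<Sum>a\<in>A. (real (card (?N a)))\<^sup>2)"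
    using sum_squared_le_sum_of_squares[of "\<lambda>a. real (card (?N a))" A] by (simp add: mult.commute)
  then have "real ((card G)\<^sup>2) \<le> real (card A * card {(a, b, c). (a, b) \<in> G \<and> (a, c) \<in> G})"
    unfolding G E by simp
  then show ?thesis by (simp only: of_nat_le_iff)
qed

lemma max_sumset_prodset_ge:
  assumes "finite A" "finite B" "G \<subseteq> A \<times> B"
  shows "real (max (card (sumset_along G A B)) (card (prodset_along G A B)))
    \<ge> (1/31) powr (3/8) * (real (card G) powr (3/4) / real (card A) powr (3/8))"
proof (cases "G = {}")
  case True
  then show ?thesis by simp
next
  case False
  let ?S = "sumset_along G A B" and ?P = "prodset_along G A B"
  define M where "M = max (card ?S) (card ?P)"
  have finG: "finite G" using assms finite_subset by blast
  have "?S = (\<lambda>(a, b). a + b) ` G" "?P = (\<lambda>(a, b). a * b) ` G"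
    using assms(3) unfolding sumset_along_def prodset_along_def by force+
  then have SP: "finite ?S" "finite ?P" "\<And>a b. (a, b) \<in> G \<Longrightarrow> a + b \<in> ?S \<and> a * b \<in> ?P"
    using finG by force+
  have "A \<noteq> {}" using False assms(3) by auto
  then have A: "real (card A) > 0" using assms(1) by (simp add: card_gt_0_iff)
  have G: "real (card G) > 0" using finG False by (simp add: card_gt_0_iff)
  have "(card G)\<^sup>2 \<le> card A * card {(a, b, c). (a, b) \<in> G \<and> (a, c) \<in> G}"
    by (rule card_edges_squared_le) (use assms finG in auto)
  then have "real ((card G)\<^sup>2) \<le> real (card A * card {(a, b, c). (a, b) \<in> G \<and> (a, c) \<in> G})"
    by (simp only: of_nat_le_iff)
  also have "\<dots> \<le> real (card A) * (31 * real M powr (8/3))"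
    using card_all_cherries_le[OF finG SP(1,2,3), of M] by (simp add: M_def mult_left_mono)
  finally have "1/31 * ((real (card G))\<^sup>2 / real (card A)) \<le> real M powr (8/3)"
    using A by (simp add: field_simps)
  \<comment> \<open>The exponent 3/8 inverts 8/3 and is the source of the constant
    \<open>(1/31) powr (3/8)\<close>.\<close>
  then have "(1/31 * ((real (card G))\<^sup>2 / real (card A))) powr (3/8) \<le> (real M powr (8/3)) powr (3/8)"
    using A by (intro powr_mono2) auto
  also have "\<dots> = real M"
    by (simp add: powr_powr)
  also have "(1/31 * ((real (card G))\<^sup>2 / real (card A))) powr (3/8) =
      (1/31) powr (3/8) * (((real (card G))\<^sup>2) powr (3/8) / real (card A) powr (3/8))"
    using A by (simp only: powr_mult powr_divide)
  also have "((real (card G))\<^sup>2) powr (3/8) = real (card G) powr (3/4)"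
    using G by (simp add: powr_powr flip: powr_numeral)
  finally show ?thesis by (simp add: M_def)
qed

text \<open>Density gives \<open>n powr (3/8) \<le> g powr \<delta>\<close> with
  \<open>\<delta> = (3/8) / (3/2 + \<epsilon>)\<close>, and \<open>3/4 - \<delta>\<close> is the
  claimed exponent. At \<open>n = 0\<close> the right side is 0 by the convention for division, so
  \<open>g = 0\<close> is demanded there.\<close>

lemma powr_quotient_ge_of_dense:
  fixes g n \<epsilon> :: real
  assumes "\<epsilon> > 0" "n \<ge> 0" "g \<ge> n powr (3/2 + \<epsilon>)" and g: "n = 0 \<Longrightarrow> g = 0"
  shows "g powr (1/2 + 4 * \<epsilon> / (24 + 16 * \<epsilon>)) \<le> g powr (3/4) / n powr (3/8)"
proof (cases "n = 0")
  case True
  then show ?thesis using g by simp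
next
  case False
  then have n: "n > 0" using assms by simp
  then have gpos: "g > 0" using assms(3) powr_gt_zero[of n "3/2 + \<epsilon>"] by linarith
  define \<delta> where "\<delta> = 3 / 8 / (3/2 + \<epsilon>)"
  have "n powr (3/8) = (n powr (3/2 + \<epsilon>)) powr \<delta>"
  proof -
    have "(3/2 + \<epsilon>) * \<delta> = 3/8"
      using assms(1) by (simp add: \<delta>_def divide_simps)
    then show ?thesis by (simp only: powr_powr)
  qed
  also have "\<dots> \<le> g powr \<delta>"
    using assms by (intro powr_mono2) (auto simp: \<delta>_def)
  finally have "g powr (3/4) / g powr \<delta> \<le> g powr (3/4) / n powr (3/8)"
    using n gpos by (intro divide_left_mono mult_pos_pos) auto
  moreover have "3/4 - \<delta> = 1/2 + 4 * \<epsilon> / (24 + 16 * \<epsilon>)"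
    using assms(1) by (simp add: \<delta>_def divide_simps)
  ultimately show ?thesis
    by (simp flip: powr_diff)
qed

theorem theorem6p1:
  "(\<exists>c::real. c > 0 \<and>
      (\<forall>(A::real set) (B::real set) (G::(real \<times> real) set).
         finite A \<longrightarrow> finite B \<longrightarrow> G \<subseteq> A \<times> B \<longrightarrow>
         real (max (card (sumset_along G A B)) (card (prodset_along G A B)))
           \<ge> c * (real (card G) powr (3/4) / real (card A) powr (3/8)))) \<and>
   (\<exists>c::real. c > 0 \<and>
      (\<forall>\<epsilon>::real. \<epsilon> > 0 \<longrightarrow>
        (\<forall>(A::real set) (B::real set) (G::(real \<times> real) set).
           finite A \<longrightarrow> finite B \<longrightarrow> G \<subseteq> A \<times> B \<longrightarrow>
           real (card G) \<ge> real (card A) powr (3/2 + \<epsilon>) \<longrightarrow>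
           real (max (card (sumset_along G A B)) (card (prodset_along G A B)))
             \<ge> c * real (card G) powr (1/2 + 4 * \<epsilon> / (24 + 16 * \<epsilon>)))))"
proof (intro conjI)
  show "\<exists>c::real. c > 0 \<and>
      (\<forall>(A::real set) (B::real set) (G::(real \<times> real) set).
         finite A \<longrightarrow> finite B \<longrightarrow> G \<subseteq> A \<times> B \<longrightarrow>
         real (max (card (sumset_along G A B)) (card (prodset_along G A B)))
           \<ge> c * (real (card G) powr (3/4) / real (card A) powr (3/8)))"
    by (intro exI[of _ "(1/31) powr (3/8)"] conjI allI impI max_sumset_prodset_ge) auto
  show "\<exists>c::real. c > 0 \<and>
      (\<forall>\<epsilon>::real. \<epsilon> > 0 \<longrightarrow>
        (\<forall>(A::real set) (B::real set) (G::(real \<times> real) set).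
           finite A \<longrightarrow> finite B \<longrightarrow> G \<subseteq> A \<times> B \<longrightarrow>
           real (card G) \<ge> real (card A) powr (3/2 + \<epsilon>) \<longrightarrow>
           real (max (card (sumset_along G A B)) (card (prodset_along G A B)))
             \<ge> c * real (card G) powr (1/2 + 4 * \<epsilon> / (24 + 16 * \<epsilon>))))"
  \<comment> \<open>The constant of the first bound serves for every \<open>\<epsilon>\<close>,
    because passing to the power of \<open>card G\<close> loses no factor.\<close>
  proof (intro exI[of _ "(1/31) powr (3/8)"] conjI allI impI)
    fix \<epsilon> :: real and A B :: "real set" and G :: "(real \<times> real) set"
    assume "\<epsilon> > 0" and *: "finite A" "finite B" "G \<subseteq> A \<times> B"
      and "real (card G) \<ge> real (card A) powr (3/2 + \<epsilon>)"
    moreover have "real (card G) = 0" if "real (card A) = 0"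
      using that * by auto
    ultimately have "real (card G) powr (1/2 + 4 * \<epsilon> / (24 + 16 * \<epsilon>))
        \<le> real (card G) powr (3/4) / real (card A) powr (3/8)"
      by (intro powr_quotient_ge_of_dense) auto
    then have "(1/31) powr (3/8) * real (card G) powr (1/2 + 4 * \<epsilon> / (24 + 16 * \<epsilon>))
        \<le> (1/31) powr (3/8) * (real (card G) powr (3/4) / real (card A) powr (3/8))"
      by (rule mult_left_mono) simp
    also have "\<dots> \<le> real (max (card (sumset_along G A B)) (card (prodset_along G A B)))"
      by (rule max_sumset_prodset_ge[OF *])
    finally show "real (max (card (sumset_along G A B)) (card (prodset_along G A B)))
        \<ge> (1/31) powr (3/8) * real (card G) powr (1/2 + 4 * \<epsilon> / (24 + 16 * \<epsilon>))" .
  qed simp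
qed

end
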